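(* Let $A\in\mathbb{R}^{n\times n}\setminus\{0\}$ be symmetric positive semidefinite, let $M\in\mathbb{R}^{n\times n}$ satisfy $\|I-MA\|_A\le 1$, and let $P\in\mathbb{R}^{n\times n_{\rm c}}$ with $n_{\rm c}<n$ be such that $A_{\rm c}:=P^{T}AP$ is nonzero. Put $\overline{M}:=M+M^{T}-M^{T}AM$ and assume $$\mathcal{N}\big(A^{\frac12}\overline{M}A^{\frac12}\big)\cap\mathcal{N}\big(P^{T}(I-AM)A^{\frac12}\big)=\mathcal{N}(A).$$ Let $r=\operatorname{rank}(A)$ and $s=\operatorname{rank}(A_{\rm c})$, and assume $s<r$. Let $\mathbf{f}\in\mathcal{R}(A)$, let $\mathbf{u}\in\mathbb{R}^n$ satisfy $A\mathbf{u}=\mathbf{f}$, let $\mathbf{u}^{(0)}\in\mathbb{R}^n$, and let $\mathscr{B}_{\rm c}:\mathbb{R}^{n_{\rm c}}\to\mathbb{R}^{n_{\rm c}}$ be an arbitrary (not necessarily linear) mapping. Set $$\mathbf{u}^{(1)}=\mathbf{u}^{(0)}+M\big(\mathbf{f}-A\mathbf{u}^{(0)}\big),\quad \mathbf{r}_{\rm c}=P^{T}\big(\mathbf{f}-A\mathbf{u}^{(1)}\big),\quad \mathbf{e}_{\rm c}=A_{\rm c}^{\dagger}\mathbf{r}_{\rm c},\quad \hat{\mathbf{e}}_{\rm c}=\mathscr{B}_{\rm c}(\mathbf{r}_{\rm c}),$$ $$\mathbf{u}_{\rm TG}=\mathbf{u}^{(1)}+P\mathbf{e}_{\rm c},\qquad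 \mathbf{u}_{\rm ITG}=\mathbf{u}^{(1)}+P\hat{\mathbf{e}}_{\rm c}.$$ Let $\rho,\varepsilon\in[0,1)$. If $$\|\mathbf{u}-\mathbf{u}_{\rm TG}\|_{A}\le\rho\,\|\mathbf{u}-\mathbf{u}^{(0)}\|_{A}\qquad\text{and}\qquad \|\mathbf{e}_{\rm c}-\hat{\mathbf{e}}_{\rm c}\|_{A_{\rm c}}\le\varepsilon\,\|\mathbf{e}_{\rm c}\|_{A_{\rm c}},$$ then $$\|\mathbf{u}-\mathbf{u}_{\rm ITG}\|_{A}\le\sqrt{\rho^{2}+\varepsilon^{2}\Big(1-\max\big\{\rho^{2}+\lambda_{n-r+1}(\widetilde{M}A),\ \delta_{\rm TG}\big\}\Big)}\;\|\mathbf{u}-\mathbf{u}^{(0)}\|_{A},$$ where $\widetilde{M}:=M+M^{T}-MAM^{T}$, $\Pi_{A}:=PA_{\rm c}^{\dagger}P^{T}A$ and $$\delta_{\rm TG}=\begin{cases}\lambda_{n-s+1}(\widetilde{M}A\Pi_{A}) & \text{if }\mathcal{N}\big(A^{\frac12}\widetilde{M}A^{\frac12}\big)\cap\mathcal{R}\big(A^{\frac12}P\big)=\{0\},\\ 0&\text{otherwise.}\end{cases}$$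
   Context: $\mathcal{N}(\cdot)$ and $\mathcal{R}(\cdot)$ denote null space and column space, $(\cdot)^{\dagger}$ the Moore--Penrose inverse, and $A^{\frac12}$ the symmetric positive semidefinite square root of $A$. For a matrix with real eigenvalues, $\lambda_i(\cdot)$ denotes its $i$th smallest eigenvalue (counted with algebraic multiplicity); the eigenvalues of $\widetilde{M}A$ and $\widetilde{M}A\Pi_A$ are real. For a symmetric positive semidefinite matrix $S$ and a vector $\mathbf{v}$ of matching size, $\|\mathbf{v}\|_S:=\sqrt{\mathbf{v}^{T}S\mathbf{v}}$. For $X\in\mathbb{R}^{n\times n}$, $$\|X\|_A:=\sup_{\mathbf{v}\in\mathbb{R}^n\setminus\mathcal{N}(A)}\frac{\|X\mathbf{v}\|_A}{\|\mathbf{v}\|_A}\in[0,+\infty].$$ $\mathbf{u}_{\rm TG}$ and $\mathbf{u}_{\rm ITG}$ are the outputs of one step of the exact and the inexact two-grid method, respectively, started at $\mathbf{u}^{(0)}$. *)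

theory Defs
  imports
    "HOL-Analysis.Analysis"
    "HOL-Computational_Algebra.Computational_Algebra"
begin

definition nullspace :: "real^'n^'m \<Rightarrow> (real^'n) set" where
  "nullspace A = {v. A *v v = 0}"

definition colspace :: "real^'n^'m \<Rightarrow> (real^'m) set" where
  "colspace A = range (\<lambda>v. A *v v)"

definition sym_psd :: "real^'n^'n \<Rightarrow> bool" where
  "sym_psd A \<longleftrightarrow> transpose A = A \<and> (\<forall>v. 0 \<le> v \<bullet> (A *v v))"

text \<open>The positive semidefinite square root; meaningful for symmetric positive semidefinite
  arguments, for which it exists and is unique.\<close>

definition psd_sqrt :: "real^'n^'n \<Rightarrow> real^'n^'n" where
  "psd_sqrt A = (THE B. sym_psd B \<and> B ** B = A)"

text \<open>The Moore--Penrose inverse, characterised by the four Penrose equations; every real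
  matrix has exactly one such inverse.\<close>

definition pinv :: "real^'n^'m \<Rightarrow> real^'m^'n" where
  "pinv A = (THE X. A ** X ** A = A \<and> X ** A ** X = X \<and>
     transpose (A ** X) = A ** X \<and> transpose (X ** A) = X ** A)"

definition charpoly :: "real^'n^'n \<Rightarrow> real poly" where
  "charpoly A = det (mat [:0, 1:] - (\<chi> i j. [:A $ i $ j:]))"

text \<open>The \<open>i\<close>-th smallest eigenvalue, \<open>i\<close> counted from 1, with algebraic multiplicity.
  \<^const>\<open>proots\<close> collects the real roots only, so this is meant for matrices all of whose
  eigenvalues are real, and for \<open>1 \<le> i \<le> n\<close>.\<close>

definition eigval :: "nat \<Rightarrow> real^'n^'n \<Rightarrow> real" where
  "eigval i A = sorted_list_of_multiset (proots (charpoly A)) ! (i - 1)"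

definition seminorm_of :: "real^'n^'n \<Rightarrow> real^'n \<Rightarrow> real" where
  "seminorm_of S v = sqrt (v \<bullet> (S *v v))"

definition op_seminorm :: "real^'n^'n \<Rightarrow> real^'n^'n \<Rightarrow> ennreal" where
  "op_seminorm A X =
     (SUP v \<in> - nullspace A. ennreal (seminorm_of A (X *v v) / seminorm_of A v))"

end

theory Submission
  imports Defs
begin

text \<open>
  Everything is measured in the energy form \<open>q(v) = v \<bullet> A v\<close>. Write \<open>e0 = u - u0\<close> for the initial
  error, \<open>e1 = (I - M A) e0\<close> for the smoothed error and \<open>Q\<close> for the coarse-grid correction
  \<open>\<Pi>\<^sub>A\<close>. Since \<open>Q\<close> is the energy-orthogonal projection onto the range of \<open>P\<close>
  (lemma \<open>sym_psd_coarse_form\<close>), the exact two-grid error is \<open>e1 - Q e1\<close>, and an inexact coarse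
  solution perturbs it by a vector in the range of \<open>P\<close>, orthogonally to it. Pythagoras gives

  \<open>q(u - u_ITG) \<le> q(u - u_TG) + \<epsilon>\<^sup>2 q(Q e1)\<close> and \<open>q(e1) = q(u - u_TG) + q(Q e1)\<close>.

  With \<open>q(u - u_TG) \<le> \<rho>\<^sup>2 q(e0)\<close>, the two terms of the maximum come from two estimates of the
  smoother: \<open>q(e1) \<le> (1 - \<lambda>) q(e0)\<close>, where \<open>\<lambda>\<close> is the relevant eigenvalue of \<open>Mtilde A\<close>, and
  \<open>q(Q e1) \<le> (1 - \<delta>_TG) q(e0)\<close>. Each of them bounds the norm of an operator, \<open>I - M A\<close> or
  \<open>Q (I - M A)\<close>, and passes to the adjoint \<open>I - M\<^sup>T A\<close> on the range of the projection
  (lemma \<open>energy_le_of_adjoint_energy_le\<close>). The adjoint satisfies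
  \<open>q((I - M\<^sup>T A) y) = q(y) - A y \<bullet> Mtilde (A y)\<close>, so what is needed is a lower bound for a Rayleigh
  quotient: \<open>A v \<bullet> Mtilde (A v) \<ge> \<lambda> (v \<bullet> A v)\<close>, and the same with the positive semidefinite
  matrix \<open>A Q\<close> in place of \<open>A\<close>.

  Lemma \<open>eigval_le_Rayleigh_quotient\<close> provides this for a product of a symmetric matrix with a
  positive semidefinite one when the form being bounded is nonnegative; for \<open>Mtilde\<close> this holds
  because the adjoint smoother is a contraction as well. The lemma compares the minimum of the quotient with the ordered list of
  eigenvalues by counting the algebraic multiplicity of 0, for which
  \<open>dim_kernel_square_le_order_charpoly\<close> gives a lower bound.
\<close>

text \<open>The infix dollar sign is reserved for vector components; formal power series use it as well,
  which makes every matrix entry ambiguous.\<close>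

no_notation fps_nth (infixl \<open>$\<close> 75)

section \<open>Characteristic polynomials\<close>

lemma poly_det: "poly (det F) x = det (\<chi> i j. poly (F $ i $ j) x)" for F :: "real poly^'n^'n"
  by (simp add: det_def poly_sum poly_prod of_int_poly)

lemma poly_charpoly: "poly (charpoly N) x = det (mat x - N)"
  unfolding charpoly_def poly_det
  by (rule arg_cong[where f = det]) (simp add: vec_eq_iff mat_def)

lemma poly_charpoly_eq_0_iff: "poly (charpoly N) x = 0 \<longleftrightarrow> (\<exists>v. v \<noteq> 0 \<and> N *v v = x *\<^sub>R v)"
proof -
  have e: "(mat x - N) *v v = x *\<^sub>R v - N *v v" for v
    by (simp add: matrix_vector_mult_diff_rdistrib)
       (simp add: vec_eq_iff mat_def matrix_vector_mult_def if_distrib if_distribR sum.delta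
        cong: if_cong)
  have "poly (charpoly N) x = 0 \<longleftrightarrow> (\<exists>v. v \<noteq> 0 \<and> (mat x - N) *v v = 0)"
    unfolding poly_charpoly det_eq_0_rank matrix_nonfull_linear_equations_eq
    using rank_bound[of "mat x - N"] by auto
  then show ?thesis unfolding e by auto
qed

text \<open>A real number above the operator norm of \<open>N\<close> is not an eigenvalue, hence not a root.\<close>

lemma charpoly_neq_0: "charpoly N \<noteq> 0"
proof
  assume "charpoly N = 0"
  then have "poly (charpoly N) (onorm ((*v) N) + 1) = 0" by simp
  then obtain v where v: "v \<noteq> 0" "N *v v = (onorm ((*v) N) + 1) *\<^sub>R v"
    unfolding poly_charpoly_eq_0_iff by blast
  have "norm (N *v v) \<le> onorm ((*v) N) * norm v"
    by (rule onorm) simp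
  moreover have "onorm ((*v) N) \<ge> 0" by (rule onorm_pos_le) simp
  ultimately show False using v by (simp only: norm_scaleR) (simp add: algebra_simps)
qed

text \<open>A change of basis adapted to a subspace \<open>K\<close>: extend a basis of \<open>K\<close> to one of the whole
  space and use the vectors as columns.\<close>

lemma invertible_matrix_extending_subspace_basis:
  fixes K :: "(real^'n) set"
  assumes "subspace K"
  obtains R :: "real^'n^'n" and J where
    "det R \<noteq> 0" "card J = dim K" "\<And>j. j \<in> J \<Longrightarrow> column j R \<in> K"
proof -
  obtain B0 where B0: "B0 \<subseteq> K" "independent B0" "K \<subseteq> span B0" "card B0 = dim K"
    by (rule basis_exists)
  obtain B where B: "B0 \<subseteq> B" "independent B" "span B = UNIV"
    using maximal_independent_subset_extend[of B0 UNIV] B0(2) by (metis subset_UNIV top.extremum_uniqueI)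
  have cB: "card B = CARD('n)" using B
    by (metis dim_UNIV dim_eq_card dim_vec_eq span_UNIV vec_dim_card)
  have fB: "finite B" using B(2) independent_imp_finite by blast
  then obtain b :: "'n \<Rightarrow> real^'n" where b: "bij_betw b UNIV B"
    using finite_same_card_bij[of "UNIV :: 'n set" B] cB by auto
  define R :: "real^'n^'n" where "R = (\<chi> i j. b j $ i)"
  have col: "column j R = b j" for j by (simp add: R_def column_def vec_eq_iff)
  have "rank R = CARD('n)"
  proof -
    have "columns R = B" using b by (auto simp: columns_def col bij_betw_def)
    then show ?thesis using cB B(2) dim_eq_card[of B B]
      by (simp add: column_rank_def)
  qed
  then have "det R \<noteq> 0" by (simp add: det_eq_0_rank)
  moreover have "card {j. b j \<in> B0} = dim K"
  proof -
    have "b ` {j. b j \<in> B0} = B0" using b B(1) by (force simp: bij_betw_def)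
    moreover have "inj_on b {j. b j \<in> B0}" using b by (metis bij_betw_def inj_on_subset subset_UNIV)
    ultimately show ?thesis using B0(4) card_image by fastforce
  qed
  ultimately show ?thesis using that[of R "{j. b j \<in> B0}"] col B0(1) by auto
qed

text \<open>Substituting \<open>-x\<close> for \<open>x\<close> does not move the root 0, and so keeps its multiplicity.\<close>

lemma order_0_le_of_reflection:
  fixes p q :: "real poly"
  assumes "p \<noteq> 0" "q \<noteq> 0" and "c \<noteq> 0" and pq: "\<And>x. poly q x = c * poly p (- x)"
  shows "order 0 p \<le> order 0 q"
proof -
  have q: "q = smult c (p \<circ>\<^sub>p [:0, -1:])"
    unfolding poly_eq_poly_eq_iff[symmetric] by (auto simp: poly_pcompose pq fun_eq_iff)
  have "[:-0, 1:] ^ order 0 p dvd p" by (rule order_1)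
  then obtain g where g: "p = [:0, 1:] ^ order 0 p * g" by (auto simp: dvd_def)
  have "q = smult c (([:0,1:] ^ order 0 p \<circ>\<^sub>p [:0,-1:]) * (g \<circ>\<^sub>p [:0,-1:]))"
    unfolding q by (subst g) (simp only: pcompose_mult)
  moreover have "[:0,1:] ^ k \<circ>\<^sub>p [:0,-1::real:] = smult ((-1)^k) ([:0,1:]^k)" for k
    unfolding poly_eq_poly_eq_iff[symmetric]
    by (auto simp: poly_pcompose fun_eq_iff poly_power power_mult_distrib[symmetric])
  ultimately have "[:-0,1:] ^ order 0 p dvd q" by (simp add: dvd_smult)
  then show ?thesis using assms(2) order_divides by blast
qed

text \<open>Bounding the algebraic multiplicity of 0 by the kernel of \<open>N\<^sup>2\<close> rather than of \<open>N\<close> matters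
  below: the matrices met there are products of two symmetric ones, are not symmetric themselves,
  and may be nilpotent on the part of the space that has to be counted.

  In a basis \<open>R\<close> some of whose columns span the kernel of \<open>N\<^sup>2\<close>, the same columns of
  \<open>(X I + N) (X I - N) R = (X\<^sup>2 I - N\<^sup>2) R\<close> are multiples of \<open>X\<^sup>2\<close>. So \<open>X\<close> to twice the
  dimension divides the product of \<open>p(X) = det (X I - N)\<close>, \<open>det (X I + N) = \<plusminus> p(-X)\<close> and a nonzero
  constant, and the first two factors have the same multiplicity at 0.\<close>

lemma dim_kernel_square_le_order_charpoly:
  fixes N :: "real^'n^'n"
  shows "dim {v. N *v (N *v v) = 0} \<le> order 0 (charpoly N)"
proof -
  define K where "K = {v. N *v (N *v v) = 0}"
  define X where "X = [:0, 1 :: real:]"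
  define C where "C = (\<lambda>F :: real^'n^'n. (\<chi> i j. [:F $ i $ j:]))"
  have "subspace K" by (auto simp: K_def subspace_def matrix_vector_right_distrib matrix_vector_mult_scaleR)
  then obtain R :: "real^'n^'n" and J where R: "det R \<noteq> 0" and J: "card J = dim K"
    and RJ: "\<And>j. j \<in> J \<Longrightarrow> column j R \<in> K"
    using invertible_matrix_extending_subspace_basis by blast
  define p where "p = charpoly N"
  define q where "q = det (mat X + C N)"
  have p: "p = det (mat X - C N)" by (simp add: p_def charpoly_def X_def C_def)
  have pq: "poly q x = (-1) ^ CARD('n) * poly p (- x)" for x
  proof -
    have "poly q x = det (mat x + N)"
      unfolding q_def poly_det
      by (rule arg_cong[where f = det]) (simp add: vec_eq_iff mat_def X_def C_def)
    also have "mat x + N = (\<chi> i. (-1) *s (mat (- x) - N) $ i)"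
      by (simp add: vec_eq_iff mat_def)
    also have "det \<dots> = (-1) ^ CARD('n) * poly p (- x)"
      unfolding p_def poly_charpoly by (subst det_rows_mul) (simp add: vec_lambda_eta)
    finally show ?thesis .
  qed
  have p0: "p \<noteq> 0" by (simp add: p_def charpoly_neq_0)
  have q0: "q \<noteq> 0"
  proof
    assume "q = 0"
    then have "poly p (- x) = 0" for x using pq[of x] by simp
    then have "poly p x = 0" for x by (metis minus_minus)
    then show False using p0 poly_all_0_iff_0 by blast
  qed
  have qp: "order 0 q \<le> order 0 p"
  proof (rule order_0_le_of_reflection[OF q0 p0])
    show "(-1 :: real) ^ CARD('n) \<noteq> 0" by simp
    show "poly p x = (-1) ^ CARD('n) * poly q (- x)" for x
      unfolding pq by (simp add: power_mult_distrib[symmetric] mult.assoc[symmetric])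
  qed
  define d where "d = det (C R)"
  have d: "poly d x = det R" for x
    unfolding d_def poly_det by (rule arg_cong[where f = det]) (simp add: vec_eq_iff C_def)
  have d0: "d \<noteq> 0" "order 0 d = 0" using d R by (auto intro: order_0I)
  define E where "E = (mat X + C N) ** (mat X - C N) ** C R"
  have detE: "det E = q * p * d"
    by (simp add: E_def det_mul p q_def d_def)
  have Csum: "(\<Sum>k\<in>UNIV. [:g k:]) = [:\<Sum>k\<in>UNIV. g k :: real:]" for g :: "'n \<Rightarrow> real"
    by (simp add: poly_eq_poly_eq_iff[symmetric] fun_eq_iff poly_sum)
  have Cmul: "C F ** C G = C (F ** G)" for F G
    by (simp add: C_def vec_eq_iff matrix_matrix_mult_def Csum mult.commute)
  have mX: "mat X ** F = (\<chi> i j. X * F $ i $ j)" "F ** mat X = (\<chi> i j. X * F $ i $ j)"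
    for F :: "real poly^'n^'n"
    by (simp_all add: vec_eq_iff matrix_matrix_mult_def mat_def if_distrib if_distribR
        sum.delta mult.commute cong: if_cong)
  have dist: "(F + G) ** H = F ** H + G ** H" "F ** (G - H) = F ** G - F ** H"
    "(F - G) ** H = F ** H - G ** H" for F G H :: "real poly^'n^'n"
    by (simp_all add: vec_eq_iff matrix_matrix_mult_def sum.distrib sum_subtractf algebra_simps)
  have "E = mat X ** (mat X ** C R) - C (N ** N ** R)"
  proof -
    have "C N ** (mat X ** C R) = mat X ** C (N ** R)"
      by (metis Cmul mX matrix_mul_assoc)
    then show ?thesis
      unfolding E_def by (simp add: dist matrix_mul_assoc[symmetric] Cmul)
  qed
  then have Eij: "E $ i $ j = X ^ 2 * [:R $ i $ j:] - [:(N *v (N *v column j R)) $ i:]" for i j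
    by (simp add: mX C_def power2_eq_square matrix_vector_mul_assoc mult.assoc)
       (simp add: matrix_matrix_mult_def matrix_vector_mult_def column_def)
  define c where "c = (\<lambda>j. if j \<in> J then X ^ 2 else 1)"
  have "transpose E = (\<chi> j. c j *s (\<chi> i. if j \<in> J then [:R $ i $ j:] else E $ i $ j))"
  proof -
    have "N *v (N *v column j R) = 0" if "j \<in> J" for j using RJ[OF that] by (simp add: K_def)
    then show ?thesis by (simp add: vec_eq_iff transpose_def c_def Eij)
  qed
  then have "det (transpose E)
      = prod c UNIV * det (\<chi> j. (\<chi> i. if j \<in> J then [:R $ i $ j:] else E $ i $ j))"
    by (simp only: det_rows_mul)
  then have "det E = prod c UNIV * det (\<chi> j. (\<chi> i. if j \<in> J then [:R $ i $ j:] else E $ i $ j))"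
    by (simp only: det_transpose)
  moreover have "prod c UNIV = X ^ (2 * dim K)"
    by (simp add: c_def prod.If_cases J power_mult)
  ultimately have "[:-0, 1:] ^ (2 * dim K) dvd q * p * d"
    unfolding detE by (simp add: X_def)
  moreover have "q * p * d \<noteq> 0" using p0 q0 d0 by simp
  ultimately have "2 * dim K \<le> order 0 (q * p * d)" using order_divides by blast
  also have "\<dots> = order 0 q + order 0 p" using p0 q0 d0 by (simp add: order_mult)
  finally show ?thesis using qp by (simp add: K_def p_def)
qed

lemma sorted_nth_le_of_count_le:
  fixes Ms :: "real multiset"
  assumes "j < size {#x \<in># Ms. x \<le> \<mu>#}"
  shows "sorted_list_of_multiset Ms ! j \<le> \<mu>"
proof (rule ccontr)
  define xs where "xs = sorted_list_of_multiset Ms"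
  have m: "mset xs = Ms" and s: "sorted xs" by (simp_all add: xs_def)
  assume "\<not> ?thesis"
  then have gt: "\<mu> < xs ! j" by (simp add: xs_def)
  have "size {#x \<in># Ms. x \<le> \<mu>#} = length (filter (\<lambda>x. x \<le> \<mu>) xs)"
    by (metis m mset_filter size_mset)
  also have "\<dots> = card {i. i < length xs \<and> xs ! i \<le> \<mu>}" by (rule length_filter_conv_card)
  also have "\<dots> \<le> card {..<j}"
  proof (rule card_mono)
    show "{i. i < length xs \<and> xs ! i \<le> \<mu>} \<subseteq> {..<j}"
    proof safe
      fix i assume i: "i < length xs" "xs ! i \<le> \<mu>"
      show "i < j"
      proof (rule ccontr)
        assume "\<not> i < j"
        then have "xs ! j \<le> xs ! i" using s i(1) by (simp add: sorted_nth_mono)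
        then show False using gt i(2) by simp
      qed
    qed
  qed simp
  finally show False using assms by simp
qed

section \<open>Symmetric and positive semidefinite forms\<close>

lemma inner_transpose_matrix_vector: "x \<bullet> (transpose F *v y) = (F *v x) \<bullet> y"
  for F :: "real^'n^'m"
  by (metis dot_lmul_matrix inner_commute transpose_matrix_vector)

lemma sym_inner: "transpose F = F \<Longrightarrow> x \<bullet> (F *v y) = (F *v x) \<bullet> y"
  for F :: "real^'n^'n"
  by (metis inner_transpose_matrix_vector)

lemma quadratic_form_add:
  fixes F :: "real^'n^'n"
  assumes "transpose F = F"
  shows "(x + y) \<bullet> (F *v (x + y)) = x \<bullet> (F *v x) + 2 * (x \<bullet> (F *v y)) + y \<bullet> (F *v y)"
  using sym_inner[OF assms, of y x]
  by (simp add: matrix_vector_right_distrib inner_add_left inner_add_right inner_commute)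

text \<open>The usual discriminant argument: \<open>x + t y\<close> has nonnegative energy for all real \<open>t\<close>. When
  \<open>y\<close> has energy 0 the polynomial in \<open>t\<close> is affine, so its slope vanishes.\<close>

lemma sym_psd_Cauchy_Schwarz:
  fixes F :: "real^'n^'n"
  assumes "sym_psd F"
  shows "(x \<bullet> (F *v y))\<^sup>2 \<le> (x \<bullet> (F *v x)) * (y \<bullet> (F *v y))"
proof -
  define a b c where "a = y \<bullet> (F *v y)" and "b = x \<bullet> (F *v y)" and "c = x \<bullet> (F *v x)"
  have sym: "transpose F = F" and pos: "\<And>v. 0 \<le> v \<bullet> (F *v v)"
    using assms by (auto simp: sym_psd_def)
  have *: "0 \<le> c + 2 * t * b + t\<^sup>2 * a" for t
    using pos[of "x + t *\<^sub>R y"] unfolding quadratic_form_add[OF sym]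
    by (simp add: a_def b_def c_def matrix_vector_mult_scaleR power2_eq_square algebra_simps)
  have "a \<ge> 0" using pos by (simp add: a_def)
  have "b\<^sup>2 \<le> c * a"
  proof (cases "a = 0")
    case True
    have "b = 0"
    proof (rule ccontr)
      assume "b \<noteq> 0"
      then show False using *[of "- (c + 1) / (2 * b)"] by (simp add: True field_simps)
    qed
    then show ?thesis using True by simp
  next
    case False
    then show ?thesis using *[of "- b / a"] \<open>a \<ge> 0\<close>
      by (simp add: field_simps power2_eq_square)
  qed
  then show ?thesis by (simp add: a_def b_def c_def)
qed

lemma sym_psd_null:
  fixes F :: "real^'n^'n"
  assumes "sym_psd F" "v \<bullet> (F *v v) = 0"
  shows "F *v v = 0"
  using sym_psd_Cauchy_Schwarz[OF assms(1), of "F *v v" v] assms(2) by simp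

text \<open>The kernel of a symmetric matrix is the orthogonal complement of its range.\<close>

lemma sym_range_kernel_decomp:
  fixes F :: "real^'n^'n"
  assumes "transpose F = F"
  obtains w z where "v = F *v w + z" "F *v z = 0"
proof -
  have sub: "subspace (range ((*v) F))" by (intro linear_subspace_image) simp_all
  obtain y z where y: "y \<in> span (range ((*v) F))"
    and z: "\<And>w. w \<in> span (range ((*v) F)) \<Longrightarrow> orthogonal z w" and v: "v = y + z"
    using orthogonal_subspace_decomp_exists by blast
  have "z \<bullet> (F *v (F *v z)) = 0" using z[of "F *v (F *v z)"] by (simp add: orthogonal_def span_base)
  then have "F *v z = 0" using sym_inner[OF assms, of z "F *v z"] by simp
  moreover obtain w where "y = F *v w" using y span_eq_iff[THEN iffD2, OF sub] by auto
  ultimately show ?thesis using that v by blast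
qed

lemma dim_kernel_sym:
  fixes F :: "real^'n^'n"
  assumes "transpose F = F"
  shows "dim {v. F *v v = 0} + rank F = CARD('n)"
proof -
  have "subspace (range ((*v) F))" by (intro linear_subspace_image) simp_all
  moreover have "{y \<in> UNIV. \<forall>x\<in>range ((*v) F). orthogonal x y} = {v. F *v v = 0}"
    by (auto simp: orthogonal_def sym_inner[OF assms, symmetric])
      (metis inner_eq_zero_iff)
  ultimately show ?thesis
    using dim_subspace_orthogonal_to_vectors[of "range ((*v) F)" UNIV] by (simp add: rank_dim_range)
qed

section \<open>A Rayleigh quotient bound for products of symmetric matrices\<close>

text \<open>The eigenvalue 0, counted with multiplicity, and \<open>\<mu>\<close> itself already give \<open>j + 1\<close> eigenvalues
  that do not exceed \<open>\<mu>\<close>; the index \<open>j\<close> of a list starts at 0.\<close>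

lemma nth_eigenvalue_le_positive_root:
  fixes N :: "real^'n^'n"
  assumes "0 < \<mu>" "poly (charpoly N) \<mu> = 0" "j \<le> order 0 (charpoly N)"
  shows "sorted_list_of_multiset (proots (charpoly N)) ! j \<le> \<mu>"
proof (rule sorted_nth_le_of_count_le)
  define L where "L = {#x \<in># proots (charpoly N). x \<le> \<mu>#}"
  have "count L 0 = order 0 (charpoly N)"
    using assms(1) charpoly_neq_0[of N] by (simp add: L_def)
  moreover have "count L \<mu> > 0"
    using assms(2) order_root[of "charpoly N" \<mu>] charpoly_neq_0[of N] by (auto simp: L_def)
  moreover have "count L 0 + count L \<mu> \<le> size L"
  proof -
    have "replicate_mset (count L 0) 0 + replicate_mset (count L \<mu>) \<mu> \<subseteq># L"
      using assms(1) by (auto simp: subseteq_mset_def)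
    then show ?thesis using size_mset_mono by fastforce
  qed
  ultimately show "j < size {#x \<in># proots (charpoly N). x \<le> \<mu>#}"
    using assms(3) unfolding L_def by linarith
qed

lemma nth_eigenvalue_le_zero:
  fixes N :: "real^'n^'n"
  assumes "j < order 0 (charpoly N)"
  shows "sorted_list_of_multiset (proots (charpoly N)) ! j \<le> 0"
proof (rule sorted_nth_le_of_count_le)
  have "count {#x \<in># proots (charpoly N). x \<le> 0#} 0 = order 0 (charpoly N)"
    using charpoly_neq_0[of N] by simp
  then show "j < size {#x \<in># proots (charpoly N). x \<le> 0#}"
    using assms count_le_size[of "{#x \<in># proots (charpoly N). x \<le> 0#}" 0] by linarith
qed

text \<open>This is the spectral input of the whole argument. Both quadratic forms depend only on the
  component of \<open>v\<close> in the range of \<open>A\<close>, where \<open>v \<bullet> A v\<close> is positive away from 0. So unless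
  \<open>A = 0\<close>, the quotient attains a minimum \<open>\<mu> \<ge> 0\<close> at some \<open>v0\<close>.
  There the positive semidefinite form \<open>A S A - \<mu> A\<close> vanishes, so \<open>A (N v0) = \<mu> A v0\<close> for
  \<open>N = S A\<close>. The kernel of \<open>A\<close> has dimension at least \<open>n - k\<close> and contributes that many
  eigenvalues 0. If \<open>\<mu> > 0\<close>, then \<open>N v0\<close> is an eigenvector of \<open>N\<close> for \<open>\<mu>\<close>, and \<open>\<mu>\<close> is one
  more eigenvalue. If \<open>\<mu> = 0\<close>, then \<open>v0\<close> enlarges the kernel of \<open>N\<^sup>2\<close> beyond the kernel of
  \<open>A\<close>, and 0 occurs once more. In both cases the eigenvalue of index \<open>n - k + 1\<close> is at most
  \<open>\<mu>\<close>.\<close>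

lemma eigval_le_Rayleigh_quotient:
  fixes A S :: "real^'n^'n"
  assumes A: "sym_psd A" and S: "transpose S = S"
    and pos: "\<And>v. 0 \<le> (A *v v) \<bullet> (S *v (A *v v))" and k: "rank A \<le> k"
  shows "eigval (CARD('n) - k + 1) (S ** A) * (v \<bullet> (A *v v)) \<le> (A *v v) \<bullet> (S *v (A *v v))"
proof (cases "A *v v = 0")
  case True
  then show ?thesis by simp
next
  case False
  define N where "N = S ** A"
  define l where "l = eigval (CARD('n) - k + 1) N"
  have symA: "transpose A = A" and posA: "\<And>v. 0 \<le> v \<bullet> (A *v v)"
    using A by (auto simp: sym_psd_def)
  define q where "q = (\<lambda>v. (A *v v) \<bullet> (S *v (A *v v)))"
  define a where "a = (\<lambda>v. v \<bullet> (A *v v))"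
  define V where "V = range ((*v) A)"
  have subV: "subspace V" unfolding V_def by (intro linear_subspace_image) simp_all
  have qV: "\<exists>y\<in>V. y \<noteq> 0 \<and> q y = q x \<and> a y = a x" if "A *v x \<noteq> 0" for x
  proof -
    obtain w z where x: "x = A *v w + z" and z: "A *v z = 0"
      using sym_range_kernel_decomp[OF symA] by metis
    have Ax: "A *v x = A *v (A *v w)" by (simp add: x z matrix_vector_right_distrib)
    have "z \<bullet> (A *v (A *v w)) = 0" using sym_inner[OF symA, of z "A *v w"] z by simp
    then have "a x = a (A *v w)" by (simp add: a_def Ax) (simp add: x inner_add_left)
    moreover have "q x = q (A *v w)" by (simp add: q_def Ax)
    ultimately show ?thesis using that Ax by (intro bexI[of _ "A *v w"]) (auto simp: V_def)
  qed
  have aV: "0 < a y" if y: "y \<in> V" "y \<noteq> 0" for y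
  proof -
    have "a y \<noteq> 0"
    proof
      assume "a y = 0"
      then have "A *v y = 0" using sym_psd_null[OF A] by (simp add: a_def)
      moreover obtain w where "y = A *v w" using y by (auto simp: V_def)
      ultimately have "y \<bullet> y = 0" using sym_inner[OF symA, of y w] by simp
      then show False using y by simp
    qed
    then show ?thesis using posA[of y] by (simp add: a_def)
  qed
  \<comment> \<open>The quotient is invariant under scaling, so it is minimized over the compact unit sphere of
     the range.\<close>
  define C where "C = V \<inter> sphere 0 1"
  have "compact C" unfolding C_def
    by (intro closed_Int_compact closed_subspace subV compact_sphere)
  moreover have "C \<noteq> {}"
  proof -
    obtain y where "y \<in> V" "y \<noteq> 0" using qV[OF False] by blast
    then have "(1 / norm y) *\<^sub>R y \<in> C" using subspace_scale[OF subV] by (simp add: C_def)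
    then show ?thesis by blast
  qed
  moreover have "continuous_on C (\<lambda>y. q y / a y)"
  proof -
    have "a y \<noteq> 0" if "y \<in> C" for y
    proof -
      have "y \<in> V" "y \<noteq> 0" using that by (auto simp: C_def)
      then show ?thesis using aV[of y] by simp
    qed
    then show ?thesis unfolding q_def a_def
      by (intro continuous_intros linear_continuous_on_compose[where g="(*v) _"] continuous_on_id) simp_all
  qed
  ultimately obtain v0 where v0: "v0 \<in> C" and min: "\<And>y. y \<in> C \<Longrightarrow> q v0 / a v0 \<le> q y / a y"
    using continuous_attains_inf by (metis (no_types, lifting))
  define \<mu> where "\<mu> = q v0 / a v0"
  have av0: "0 < a v0" using aV[of v0] v0 by (cases "v0 = 0") (auto simp: C_def)
  have "\<mu> \<ge> 0" using pos[of v0] av0 by (simp add: \<mu>_def q_def)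
  have minV: "\<mu> * a y \<le> q y" if "y \<in> V" "y \<noteq> 0" for y
  proof -
    have y: "(1 / norm y) *\<^sub>R y \<in> C" using that subspace_scale[OF subV] by (simp add: C_def)
    have "q (c *\<^sub>R y) / a (c *\<^sub>R y) = q y / a y" if "c \<noteq> 0" for c
      using that by (simp add: q_def a_def matrix_vector_mult_scaleR)
    then have "\<mu> \<le> q y / a y" using min[OF y] that by (simp add: \<mu>_def)
    then show ?thesis using aV[OF that] by (simp add: field_simps)
  qed
  have minall: "\<mu> * a x \<le> q x" for x
  proof (cases "A *v x = 0")
    case True then show ?thesis by (simp add: q_def a_def)
  next
    case False then show ?thesis using qV minV by metis
  qed
  define F where "F = A ** S ** A - \<mu> *\<^sub>R A"
  have Fv: "F *v x = A *v (N *v x) - \<mu> *\<^sub>R (A *v x)" for x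
    by (simp add: F_def N_def matrix_vector_mult_diff_rdistrib matrix_vector_mul_assoc
        matrix_mul_assoc scaleR_matrix_vector_assoc)
  have FF: "x \<bullet> (F *v x) = q x - \<mu> * a x" for x
    by (simp add: Fv q_def a_def inner_diff_right N_def matrix_vector_mul_assoc[symmetric]
        sym_inner[OF symA, of x "S *v _"])
  have "transpose F = F"
  proof -
    have "transpose (A ** S ** A) = A ** S ** A"
      by (simp add: matrix_transpose_mul symA S matrix_mul_assoc)
    then show ?thesis using symA by (simp add: F_def transpose_def vec_eq_iff)
  qed
  then have "sym_psd F" using minall by (simp add: sym_psd_def FF)
  moreover have "v0 \<bullet> (F *v v0) = 0" using av0 by (simp add: FF \<mu>_def)
  ultimately have "F *v v0 = 0" by (rule sym_psd_null)
  then have ev: "A *v (N *v v0) = \<mu> *\<^sub>R (A *v v0)" by (simp add: Fv)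
  have Av0: "A *v v0 \<noteq> 0" using av0 by (auto simp: a_def)
  define K where "K = {x. A *v x = 0}"
  have KK: "K \<subseteq> {x. N *v (N *v x) = 0}" by (auto simp: K_def N_def matrix_vector_mul_assoc[symmetric])
  have dimK: "CARD('n) - k \<le> dim K" using dim_kernel_sym[OF symA] k by (simp add: K_def)
  have "l \<le> \<mu>"
  proof (cases "\<mu> = 0")
    case False
    have "N *v (N *v v0) = \<mu> *\<^sub>R (N *v v0)"
      using ev by (simp add: N_def matrix_vector_mul_assoc[symmetric] matrix_vector_mult_scaleR)
    moreover have "N *v v0 \<noteq> 0" using ev Av0 False by auto
    ultimately have "poly (charpoly N) \<mu> = 0" unfolding poly_charpoly_eq_0_iff by blast
    moreover have "CARD('n) - k \<le> order 0 (charpoly N)"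
      using dimK dim_subset[OF KK] dim_kernel_square_le_order_charpoly[of N] by linarith
    ultimately show ?thesis unfolding l_def eigval_def
      using nth_eigenvalue_le_positive_root[of \<mu> N] False \<open>\<mu> \<ge> 0\<close> by simp
  next
    case True
    have "N *v (N *v v0) = 0"
      using ev True by (simp add: N_def matrix_vector_mul_assoc[symmetric])
    then have "dim (insert v0 K) \<le> dim {x. N *v (N *v x) = 0}"
      using KK by (intro dim_subset) auto
    moreover have "subspace K" by (auto simp: K_def subspace_def matrix_vector_right_distrib matrix_vector_mult_scaleR)
    then have "v0 \<notin> span K" using Av0 by (simp add: span_eq_iff[THEN iffD2] K_def)
    then have "dim (insert v0 K) = dim K + 1" by (simp add: dim_insert)
    ultimately have "CARD('n) - k < order 0 (charpoly N)"
      using dimK dim_kernel_square_le_order_charpoly[of N] by linarith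
    then show ?thesis using True nth_eigenvalue_le_zero by (simp add: l_def eigval_def)
  qed
  then have "l * a v \<le> \<mu> * a v" using posA[of v] by (simp add: a_def mult_right_mono)
  also have "\<dots> \<le> q v" by (rule minall)
  finally show ?thesis by (simp add: l_def a_def q_def N_def)
qed

section \<open>The Moore--Penrose inverse\<close>

lemma generalized_inverse_exists:
  fixes F :: "real^'n^'m"
  obtains G where "F ** G ** F = F"
proof -
  obtain g where g: "linear g" "\<And>v. v \<in> range ((*v) F) \<Longrightarrow> F *v g v = v"
    using linear_exists_right_inverse_on[of "(*v) F" UNIV] by auto
  have "(F ** matrix g ** F) *v v = F *v v" for v
    using g by (simp add: matrix_vector_mul_assoc[symmetric])
  then have "F ** matrix g ** F = F" by (simp add: matrix_eq)
  then show ?thesis by (rule that)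
qed

lemma normal_matrix_left_cancel:
  fixes F :: "real^'n^'m" and U V :: "real^'k^'n"
  assumes "transpose F ** F ** U = transpose F ** F ** V"
  shows "F ** U = F ** V"
proof -
  have "F *v (U *v x - V *v x) = 0" for x
  proof -
    have "transpose F *v (F *v (U *v x - V *v x)) = 0"
      using arg_cong[OF assms, of "\<lambda>G. G *v x"]
      by (simp add: matrix_vector_mul_assoc[symmetric] matrix_vector_mult_diff_distrib
          del: transpose_matrix_vector)
    then have "(F *v (U *v x - V *v x)) \<bullet> (F *v (U *v x - V *v x)) = 0"
      by (metis inner_transpose_matrix_vector inner_zero_right)
    then show ?thesis by simp
  qed
  then show ?thesis
    by (simp add: matrix_eq matrix_vector_mul_assoc[symmetric] matrix_vector_mult_diff_distrib)
qed

text \<open>With \<open>G\<close> any generalized inverse of the normal matrix \<open>H = F\<^sup>T F\<close>, the matrix \<open>G F\<^sup>T\<close> solves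
  the normal equations; \<open>F G F\<^sup>T\<close> is then the orthogonal projection onto the column space.\<close>

lemma least_squares_inverse_exists:
  fixes F :: "real^'n^'m"
  obtains Y where "F ** Y ** F = F" "transpose (F ** Y) = F ** Y"
proof -
  define H where "H = transpose F ** F"
  have H: "transpose H = H" by (simp add: H_def matrix_transpose_mul)
  obtain G where G: "H ** G ** H = H" by (rule generalized_inverse_exists)
  have GT: "H ** transpose G ** H = H"
    using arg_cong[OF G, of transpose] by (simp add: matrix_transpose_mul H matrix_mul_assoc)
  define Y where "Y = G ** transpose F"
  have cancel: "F ** (K ** H) = F" if "H ** K ** H = H" for K
    using normal_matrix_left_cancel[of F "K ** H" "mat 1"] that
    by (simp add: H_def matrix_mul_assoc)
  have 1: "F ** Y ** F = F" using cancel[OF G] by (simp add: Y_def H_def matrix_mul_assoc)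
  have "H ** Y = transpose F"
    using arg_cong[OF cancel[OF GT], of transpose] by (simp add: matrix_transpose_mul H Y_def matrix_mul_assoc)
  then have "transpose Y ** (H ** Y) = transpose Y ** transpose F" by simp
  then have 2: "transpose (F ** Y) ** (F ** Y) = transpose (F ** Y)"
    by (simp add: matrix_transpose_mul H_def matrix_mul_assoc)
  then have "transpose (transpose (F ** Y) ** (F ** Y)) = F ** Y" by simp
  then have "transpose (F ** Y) ** (F ** Y) = F ** Y"
    by (simp only: matrix_transpose_mul transpose_transpose)
  then have "transpose (F ** Y) = F ** Y" using 2 by simp
  with 1 show ?thesis by (rule that)
qed

lemma penrose_unique:
  fixes F :: "real^'n^'m"
  assumes X: "F ** X ** F = F" "X ** F ** X = X" "transpose (F ** X) = F ** X" "transpose (X ** F) = X ** F"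
    and Y: "F ** Y ** F = F" "Y ** F ** Y = Y" "transpose (F ** Y) = F ** Y" "transpose (Y ** F) = Y ** F"
  shows "X = Y"
proof -
  have "transpose ((F ** Y) ** (F ** X)) = transpose (F ** X) ** transpose (F ** Y)"
    by (rule matrix_transpose_mul)
  then have "transpose (F ** X) = F ** X ** (F ** Y)"
    by (simp only: X Y matrix_mul_assoc)
  then have FX: "F ** X = F ** Y" by (simp only: X Y matrix_mul_assoc)
  have "transpose ((X ** F) ** (Y ** F)) = transpose (Y ** F) ** transpose (X ** F)"
    by (rule matrix_transpose_mul)
  then have "transpose (X ** (F ** Y ** F)) = Y ** (F ** X ** F)"
    by (simp only: X(4) Y(4) matrix_mul_assoc)
  then have XF: "X ** F = Y ** F" by (simp only: X Y)
  have "X = X ** (F ** X)" by (simp only: X matrix_mul_assoc)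
  also have "\<dots> = X ** F ** Y" by (simp only: FX matrix_mul_assoc)
  also have "\<dots> = Y" by (simp only: XF Y)
  finally show ?thesis .
qed

text \<open>Sandwiching \<open>F\<close> between an inverse \<open>W\<close> with \<open>W F\<close> symmetric and an inverse \<open>Y\<close> with
  \<open>F Y\<close> symmetric yields all four Penrose equations.\<close>

lemma pinv_penrose:
  fixes F :: "real^'n^'m"
  shows "F ** pinv F ** F = F \<and> pinv F ** F ** pinv F = pinv F \<and>
     transpose (F ** pinv F) = F ** pinv F \<and> transpose (pinv F ** F) = pinv F ** F"
  unfolding pinv_def
proof (rule theI')
  obtain Y where Y: "F ** Y ** F = F" "transpose (F ** Y) = F ** Y"
    by (rule least_squares_inverse_exists)
  obtain Z where Z: "transpose F ** Z ** transpose F = transpose F"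
      "transpose (transpose F ** Z) = transpose F ** Z"
    by (rule least_squares_inverse_exists)
  define W where "W = transpose Z"
  have W: "F ** W ** F = F" "transpose (W ** F) = W ** F"
    using arg_cong[OF Z(1), of transpose] Z(2)
    by (simp_all add: W_def matrix_transpose_mul matrix_mul_assoc)
  define X where "X = W ** F ** Y"
  have FX: "F ** X = F ** Y" using W(1) by (simp add: X_def matrix_mul_assoc)
  have "X ** F = W ** (F ** Y ** F)" by (simp add: X_def matrix_mul_assoc)
  then have XF: "X ** F = W ** F" by (simp only: Y)
  have "X ** F ** X = W ** (F ** W ** F) ** Y" unfolding XF by (simp add: X_def matrix_mul_assoc)
  then have "X ** F ** X = X" by (simp only: W X_def)
  then have "F ** X ** F = F \<and> X ** F ** X = X \<and>
     transpose (F ** X) = F ** X \<and> transpose (X ** F) = X ** F"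
    using FX XF Y W by simp
  then show "\<exists>!X. F ** X ** F = F \<and> X ** F ** X = X \<and>
     transpose (F ** X) = F ** X \<and> transpose (X ** F) = X ** F"
  proof (rule ex1I)
    fix X'
    assume "F ** X' ** F = F \<and> X' ** F ** X' = X' \<and>
       transpose (F ** X') = F ** X' \<and> transpose (X' ** F) = X' ** F"
    with \<open>F ** X ** F = F \<and> _\<close> show "X' = X"
      by (elim conjE) (rule penrose_unique[of F])
  qed
qed

lemma pinv_transpose:
  fixes F :: "real^'n^'m"
  shows "pinv (transpose F) = transpose (pinv F)"
proof (rule penrose_unique[of "transpose F"])
  have p: "F ** pinv F ** F = F" "pinv F ** F ** pinv F = pinv F"
      "transpose (F ** pinv F) = F ** pinv F" "transpose (pinv F ** F) = pinv F ** F"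
    using pinv_penrose[of F] by auto
  show "transpose F ** transpose (pinv F) ** transpose F = transpose F"
      "transpose (pinv F) ** transpose F ** transpose (pinv F) = transpose (pinv F)"
      "transpose (transpose F ** transpose (pinv F)) = transpose F ** transpose (pinv F)"
      "transpose (transpose (pinv F) ** transpose F) = transpose (pinv F) ** transpose F"
    subgoal using arg_cong[OF p(1), of transpose] by (simp add: matrix_transpose_mul matrix_mul_assoc)
    subgoal using arg_cong[OF p(2), of transpose] by (simp add: matrix_transpose_mul matrix_mul_assoc)
    subgoal by (simp only: matrix_transpose_mul[symmetric] p(4))
    subgoal by (simp only: matrix_transpose_mul[symmetric] p(3))
    done
qed (use pinv_penrose[of "transpose F"] in auto)

section \<open>The coarse-grid projection\<close>

text \<open>If \<open>d\<close> lies in the kernel of \<open>P\<^sup>T A P\<close>, then \<open>P d\<close> has energy 0 and is annihilated by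
  \<open>A\<close>; apply this to the defect of the pseudoinverse.\<close>

lemma coarse_operator_reproduces_range:
  fixes A :: "real^'n^'n" and P :: "real^'c^'n"
  assumes A: "sym_psd A" and Ac: "A\<^sub>c = transpose P ** A ** P"
  shows "A ** P ** pinv A\<^sub>c ** A\<^sub>c = A ** P"
proof -
  have "A *v (P *v (pinv A\<^sub>c *v (A\<^sub>c *v y) - y)) = 0" for y
  proof (rule sym_psd_null[OF A])
    define d where "d = pinv A\<^sub>c *v (A\<^sub>c *v y) - y"
    have "A\<^sub>c *v d = 0" using pinv_penrose[of A\<^sub>c]
      by (simp add: d_def matrix_vector_mult_diff_distrib matrix_vector_mul_assoc matrix_mul_assoc)
    moreover have "(P *v d) \<bullet> (A *v (P *v d)) = d \<bullet> (A\<^sub>c *v d)"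
      by (simp add: Ac matrix_vector_mul_assoc[symmetric] inner_transpose_matrix_vector
          del: transpose_matrix_vector)
    ultimately show "(P *v d) \<bullet> (A *v (P *v d)) = 0" by simp
  qed
  then show ?thesis
    by (simp add: matrix_eq matrix_vector_mul_assoc[symmetric] matrix_vector_mult_diff_distrib)
qed

text \<open>The coarse-grid correction \<open>Q\<close> is an orthogonal projection for the energy form: \<open>A Q\<close> is
  symmetric and \<open>Q\<close> is idempotent up to the kernel of \<open>A\<close>. Consequently \<open>A Q\<close> is itself a
  positive semidefinite matrix of rank at most that of the coarse matrix, which makes the
  product of a symmetric matrix with \<open>A Q\<close> accessible to the Rayleigh quotient bound.\<close>

lemma sym_psd_coarse_form:
  fixes A :: "real^'n^'n" and P :: "real^'c^'n"
  assumes A: "sym_psd A" and Ac: "A\<^sub>c = transpose P ** A ** P"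
    and Pi: "Q = P ** pinv A\<^sub>c ** transpose P ** A"
  shows "sym_psd (A ** Q)" and "rank (A ** Q) \<le> rank A\<^sub>c"
    and "A ** Q ** Q = A ** Q" and "A ** Q ** P = A ** P"
proof -
  have symA: "transpose A = A" and posA: "\<And>v. 0 \<le> v \<bullet> (A *v v)" using A by (auto simp: sym_psd_def)
  have "transpose A\<^sub>c = A\<^sub>c" by (simp add: Ac matrix_transpose_mul symA matrix_mul_assoc)
  then have X: "transpose (pinv A\<^sub>c) = pinv A\<^sub>c" by (metis pinv_transpose)
  note rep = coarse_operator_reproduces_range[OF A Ac]
  have "A ** Q ** P = A ** P ** pinv A\<^sub>c ** A\<^sub>c" by (simp add: Pi Ac matrix_mul_assoc)
  then show P: "A ** Q ** P = A ** P" using rep by simp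
  have "A ** Q ** Q = (A ** Q ** P) ** pinv A\<^sub>c ** transpose P ** A"
    by (subst (2) Pi) (simp add: matrix_mul_assoc)
  then show idem: "A ** Q ** Q = A ** Q" unfolding P by (simp add: Pi matrix_mul_assoc)
  have sym: "transpose (A ** Q) = A ** Q"
    by (simp add: Pi matrix_transpose_mul symA X matrix_mul_assoc)
  have "v \<bullet> ((A ** Q) *v v) = (Q *v v) \<bullet> (A *v (Q *v v))" for v
  proof -
    have "v \<bullet> ((A ** Q) *v v) = v \<bullet> ((A ** Q) *v (Q *v v))"
      by (simp add: matrix_vector_mul_assoc idem)
    also have "\<dots> = (A *v (Q *v v)) \<bullet> (Q *v v)"
      by (subst sym_inner[OF sym]) (simp add: matrix_vector_mul_assoc)
    finally show ?thesis by (simp add: inner_commute)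
  qed
  then show "sym_psd (A ** Q)" using sym posA by (simp add: sym_psd_def)
  have "A ** Q = A ** P ** pinv A\<^sub>c ** A\<^sub>c ** (pinv A\<^sub>c ** transpose P ** A)"
  proof -
    have "A ** P ** pinv A\<^sub>c ** A\<^sub>c ** (pinv A\<^sub>c ** transpose P ** A)
        = A ** P ** (pinv A\<^sub>c ** A\<^sub>c ** pinv A\<^sub>c) ** transpose P ** A"
      by (simp only: matrix_mul_assoc)
    then show ?thesis using pinv_penrose[of A\<^sub>c] by (simp add: Pi matrix_mul_assoc)
  qed
  also have "rank \<dots> \<le> rank (A ** P ** pinv A\<^sub>c ** A\<^sub>c)" by (rule rank_mul_le_left)
  also have "\<dots> \<le> rank A\<^sub>c" by (rule rank_mul_le_right)
  finally show "rank (A ** Q) \<le> rank A\<^sub>c" .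
qed

section \<open>Smoothing\<close>

text \<open>The supremum ranges over the vectors outside the kernel of \<open>A\<close>; the remaining vectors are
  covered when \<open>X\<close> maps that kernel to itself.\<close>

lemma op_seminorm_le_1_imp_energy_le:
  assumes A: "sym_psd A" and X: "op_seminorm A X \<le> 1" and ker: "\<And>v. A *v v = 0 \<Longrightarrow> A *v (X *v v) = 0"
  shows "(X *v v) \<bullet> (A *v (X *v v)) \<le> v \<bullet> (A *v v)"
proof (cases "A *v v = 0")
  case True
  then show ?thesis using ker by simp
next
  case False
  have posA: "\<And>v. 0 \<le> v \<bullet> (A *v v)" using A by (auto simp: sym_psd_def)
  have "ennreal (seminorm_of A (X *v v) / seminorm_of A v) \<le> 1"
    using X unfolding op_seminorm_def
    by (rule order_trans[OF SUP_upper, rotated]) (use False in \<open>simp add: nullspace_def\<close>)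
  then have "seminorm_of A (X *v v) / seminorm_of A v \<le> 1" by simp
  moreover have "0 < seminorm_of A v"
    using False sym_psd_null[OF A, of v] posA[of v] by (auto simp: seminorm_of_def less_le)
  ultimately show ?thesis by (simp add: seminorm_of_def)
qed

text \<open>For the energy form, \<open>I - M\<^sup>T A\<close> is the adjoint of \<open>I - M A\<close>.\<close>

lemma smoother_adjoint:
  fixes A M :: "real^'n^'n"
  assumes "transpose A = A"
  shows "x \<bullet> (A *v (y - transpose M *v (A *v y))) = (x - M *v (A *v x)) \<bullet> (A *v y)"
proof -
  have "x \<bullet> (A *v (transpose M *v (A *v y))) = (M *v (A *v x)) \<bullet> (A *v y)"
    by (simp add: sym_inner[OF assms] inner_transpose_matrix_vector del: transpose_matrix_vector)
  then show ?thesis by (simp add: matrix_vector_mult_diff_distrib inner_diff_left inner_diff_right)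
qed

text \<open>The energy removed by the adjoint smoother is a quadratic form in \<open>A y\<close> with the symmetrized
  matrix \<open>Mt\<close>; this is how the eigenvalues of \<open>Mt A\<close> enter.\<close>

lemma smoother_adjoint_energy:
  fixes A M :: "real^'n^'n"
  assumes A: "transpose A = A" and Mt: "Mt = M + transpose M - M ** A ** transpose M"
  shows "(y - transpose M *v (A *v y)) \<bullet> (A *v (y - transpose M *v (A *v y)))
    = y \<bullet> (A *v y) - (A *v y) \<bullet> (Mt *v (A *v y))"
proof -
  define t where "t = transpose M *v (A *v y)"
  have 1: "(A *v y) \<bullet> (M *v z) = t \<bullet> z" for z
    using inner_transpose_matrix_vector[of z M "A *v y"] by (simp add: t_def inner_commute)
  have "Mt *v (A *v y) = M *v (A *v y) + t - M *v (A *v t)"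
    by (simp add: Mt t_def matrix_vector_mult_diff_rdistrib matrix_vector_mult_add_rdistrib
        matrix_vector_mul_assoc[symmetric] del: transpose_matrix_vector)
  then have "(A *v y) \<bullet> (Mt *v (A *v y)) = 2 * (t \<bullet> (A *v y)) - t \<bullet> (A *v t)"
    using 1[of "A *v y"] 1[of "A *v t"]
    by (simp add: inner_diff_right inner_add_right inner_commute)
  moreover have "y \<bullet> (A *v t) = t \<bullet> (A *v y)" using sym_inner[OF A, of y t] by (simp add: inner_commute)
  ultimately show ?thesis unfolding t_def[symmetric]
    by (simp add: matrix_vector_mult_diff_distrib inner_diff_left inner_diff_right)
qed

lemma le_of_square_le_mult:
  fixes a b :: real
  assumes "a\<^sup>2 \<le> a * b" "0 \<le> a" "0 \<le> b"
  shows "a \<le> b"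
  using assms by (cases "a = 0") (auto simp: power2_eq_square)

text \<open>An operator and its adjoint have the same norm.\<close>

lemma smoother_adjoint_contraction:
  fixes A M :: "real^'n^'n"
  assumes A: "sym_psd A" and contr: "\<And>x. (x - M *v (A *v x)) \<bullet> (A *v (x - M *v (A *v x))) \<le> x \<bullet> (A *v x)"
  shows "(y - transpose M *v (A *v y)) \<bullet> (A *v (y - transpose M *v (A *v y))) \<le> y \<bullet> (A *v y)"
proof -
  have symA: "transpose A = A" and pos: "\<And>v. 0 \<le> v \<bullet> (A *v v)" using A by (auto simp: sym_psd_def)
  define w where "w = y - transpose M *v (A *v y)"
  have "(w \<bullet> (A *v w))\<^sup>2 = ((w - M *v (A *v w)) \<bullet> (A *v y))\<^sup>2"
    using smoother_adjoint[OF symA, of w y M] by (simp add: w_def)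
  also have "\<dots> \<le> ((w - M *v (A *v w)) \<bullet> (A *v (w - M *v (A *v w)))) * (y \<bullet> (A *v y))"
    by (rule sym_psd_Cauchy_Schwarz[OF A])
  also have "\<dots> \<le> (w \<bullet> (A *v w)) * (y \<bullet> (A *v y))" by (intro mult_right_mono contr pos)
  finally show ?thesis unfolding w_def[symmetric] by (rule le_of_square_le_mult) (rule pos)+
qed

text \<open>Duality: the norm of a projected operator is the norm of its adjoint restricted to the range
  of the projection. Here \<open>w\<close> is the projection of \<open>(I - M A) x\<close> in the energy form, which is
  what the last hypothesis says, and the adjoint needs to be estimated at \<open>w\<close> only.\<close>

lemma energy_le_of_adjoint_energy_le:
  fixes A M :: "real^'n^'n"
  assumes A: "sym_psd A" and c: "0 \<le> c"
    and adj: "(w - transpose M *v (A *v w)) \<bullet> (A *v (w - transpose M *v (A *v w))) \<le> c * (w \<bullet> (A *v w))"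
    and w: "w \<bullet> (A *v w) = (x - M *v (A *v x)) \<bullet> (A *v w)"
  shows "w \<bullet> (A *v w) \<le> c * (x \<bullet> (A *v x))"
proof -
  have symA: "transpose A = A" and pos: "\<And>v. 0 \<le> v \<bullet> (A *v v)" using A by (auto simp: sym_psd_def)
  define z where "z = w - transpose M *v (A *v w)"
  have "(w \<bullet> (A *v w))\<^sup>2 = (x \<bullet> (A *v z))\<^sup>2"
    using smoother_adjoint[OF symA, of x w M] w by (simp add: z_def)
  also have "\<dots> \<le> (x \<bullet> (A *v x)) * (z \<bullet> (A *v z))" by (rule sym_psd_Cauchy_Schwarz[OF A])
  also have "\<dots> \<le> (x \<bullet> (A *v x)) * (c * (w \<bullet> (A *v w)))"
    using adj by (intro mult_left_mono pos) (simp add: z_def)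
  finally have "(w \<bullet> (A *v w))\<^sup>2 \<le> (w \<bullet> (A *v w)) * (c * (x \<bullet> (A *v x)))"
    by (simp add: ac_simps)
  then show ?thesis by (rule le_of_square_le_mult) (simp_all add: pos c)
qed

section \<open>The inexact two-grid estimate\<close>

theorem theorem4p3:
  fixes A M Mbar Mtilde \<Pi>\<^sub>A :: "real^'n^'n"
    and P :: "real^'c^'n"
    and A\<^sub>c :: "real^'c^'c"
    and f u u0 u1 u_TG u_ITG :: "real^'n"
    and r\<^sub>c e\<^sub>c ehat\<^sub>c :: "real^'c"
    and B\<^sub>c :: "real^'c \<Rightarrow> real^'c"
    and r s :: nat
    and \<rho> \<epsilon> \<delta>_TG :: real
  assumes "A \<noteq> 0" and "sym_psd A"
    and "op_seminorm A (mat 1 - M ** A) \<le> 1"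
    and "CARD('c) < CARD('n)"
    and "A\<^sub>c = transpose P ** A ** P" and "A\<^sub>c \<noteq> 0"
    and "Mbar = M + transpose M - transpose M ** A ** M"
    and "nullspace (psd_sqrt A ** Mbar ** psd_sqrt A)
           \<inter> nullspace (transpose P ** (mat 1 - A ** M) ** psd_sqrt A) = nullspace A"
    and "r = rank A" and "s = rank A\<^sub>c" and "s < r"
    and "f \<in> colspace A" and "A *v u = f"
    and "u1 = u0 + M *v (f - A *v u0)"
    and "r\<^sub>c = transpose P *v (f - A *v u1)"
    and "e\<^sub>c = pinv A\<^sub>c *v r\<^sub>c"
    and "ehat\<^sub>c = B\<^sub>c r\<^sub>c"
    and "u_TG = u1 + P *v e\<^sub>c"
    and "u_ITG = u1 + P *v ehat\<^sub>c"
    and "Mtilde = M + transpose M - M ** A ** transpose M"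
    and "\<Pi>\<^sub>A = P ** pinv A\<^sub>c ** transpose P ** A"
    and "\<delta>_TG = (if nullspace (psd_sqrt A ** Mtilde ** psd_sqrt A)
                       \<inter> colspace (psd_sqrt A ** P) = {0}
                 then eigval (CARD('n) - s + 1) (Mtilde ** A ** \<Pi>\<^sub>A) else 0)"
    and "0 \<le> \<rho>" and "\<rho> < 1" and "0 \<le> \<epsilon>" and "\<epsilon> < 1"
    and "seminorm_of A (u - u_TG) \<le> \<rho> * seminorm_of A (u - u0)"
    and "seminorm_of A\<^sub>c (e\<^sub>c - ehat\<^sub>c) \<le> \<epsilon> * seminorm_of A\<^sub>c e\<^sub>c"
  shows "seminorm_of A (u - u_ITG)
           \<le> sqrt (\<rho>\<^sup>2 + \<epsilon>\<^sup>2 * (1 - max (\<rho>\<^sup>2 + eigval (CARD('n) - r + 1) (Mtilde ** A)) \<delta>_TG))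
              * seminorm_of A (u - u0)"
proof -
  note A = \<open>sym_psd A\<close>
  have symA: "transpose A = A" and posA: "\<And>v. 0 \<le> v \<bullet> (A *v v)"
    using A by (auto simp: sym_psd_def)
  define q where "q = (\<lambda>v. v \<bullet> (A *v v))"
  define Q where "Q = \<Pi>\<^sub>A"
  define lam where "lam = eigval (CARD('n) - r + 1) (Mtilde ** A)"
  note coarse = sym_psd_coarse_form[OF A \<open>A\<^sub>c = _\<close> \<open>\<Pi>\<^sub>A = _\<close>, folded Q_def]
  have q0: "0 \<le> q v" for v by (simp add: q_def posA)
  have symMt: "transpose Mtilde = Mtilde"
  proof -
    have "transpose (M ** A ** transpose M) = M ** A ** transpose M"
      by (simp add: matrix_transpose_mul symA matrix_mul_assoc)
    then show ?thesis by (simp add: \<open>Mtilde = _\<close>) (simp add: vec_eq_iff transpose_def)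
  qed
  define adj where "adj = (\<lambda>y. y - transpose M *v (A *v y))"
  have q_adj: "q (adj y) = q y - (A *v y) \<bullet> (Mtilde *v (A *v y))" for y
    using smoother_adjoint_energy[OF symA \<open>Mtilde = _\<close>] by (simp add: q_def adj_def)
  have "(mat 1 - M ** A) *v x = x - M *v (A *v x)" for x
    by (simp add: matrix_vector_mult_diff_rdistrib matrix_vector_mul_assoc)
  then have contr: "q (x - M *v (A *v x)) \<le> q x" for x
    using op_seminorm_le_1_imp_energy_le[OF A \<open>op_seminorm A _ \<le> 1\<close>, of x] by (simp add: q_def)
  have "q (adj y) \<le> q y" for y
    using smoother_adjoint_contraction[OF A] contr unfolding q_def adj_def by blast
  then have posMt: "0 \<le> (A *v y) \<bullet> (Mtilde *v (A *v y))" for y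
    using q_adj[of y] by (smt (verit))

  define e0 e1 where "e0 = u - u0" and "e1 = u - u1"
  have e1: "e1 = e0 - M *v (A *v e0)"
    using \<open>A *v u = f\<close> \<open>u1 = _\<close> by (simp add: e0_def e1_def matrix_vector_mult_diff_distrib)
  have "r\<^sub>c = transpose P *v (A *v e1)"
    using \<open>r\<^sub>c = _\<close> \<open>A *v u = f\<close> by (simp add: e1_def matrix_vector_mult_diff_distrib)
  then have Pec: "P *v e\<^sub>c = Q *v e1"
    using \<open>e\<^sub>c = _\<close> \<open>\<Pi>\<^sub>A = _\<close>
    by (simp add: Q_def matrix_vector_mul_assoc[symmetric] del: transpose_matrix_vector)
  have AP: "A *v (Q *v (P *v y)) = A *v (P *v y)" for y
    using arg_cong[OF coarse(4), of "\<lambda>F. F *v y"] by (simp add: matrix_vector_mul_assoc[symmetric])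
  have APi: "A *v (Q *v (Q *v y)) = A *v (Q *v y)" for y
    using arg_cong[OF coarse(3), of "\<lambda>F. F *v y"] by (simp add: matrix_vector_mul_assoc[symmetric])
  have Pi_adj: "x \<bullet> (A *v (Q *v y)) = (Q *v x) \<bullet> (A *v y)" for x y
    using sym_inner[of "A ** Q" x y] sym_inner[OF symA, of "Q *v x" y] coarse(1)
    by (simp add: sym_psd_def matrix_vector_mul_assoc[symmetric])

  \<comment> \<open>Some vector has positive energy, which is what forces \<open>lam \<le> 1\<close>.\<close>
  have smooth: "q e1 \<le> (1 - lam) * q e0"
  proof -
    have "lam * q y \<le> (A *v y) \<bullet> (Mtilde *v (A *v y))" for y
      unfolding lam_def q_def
      by (rule eigval_le_Rayleigh_quotient[OF A symMt posMt]) (simp add: \<open>r = _\<close>)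
    then have adj_le: "q (adj y) \<le> (1 - lam) * q y" for y
      unfolding q_adj by (simp add: algebra_simps)
    obtain v where "A *v v \<noteq> 0" using \<open>A \<noteq> 0\<close> by (auto simp: matrix_eq)
    then have "0 < q v" using sym_psd_null[OF A, of v] q0[of v] by (auto simp: q_def less_le)
    then have "0 \<le> 1 - lam" using adj_le[of v] q0[of "adj v"] by (smt (verit) mult_neg_pos)
    then show ?thesis
      using energy_le_of_adjoint_energy_le[OF A, of "1 - lam" e1 M e0] adj_le[of e1] e1
      by (simp add: q_def adj_def)
  qed

  \<comment> \<open>The same estimate with the form \<open>A Q\<close> in place of \<open>A\<close>: on the range of the projection the
     two agree. In the degenerate case the projection and the smoother are merely contractions.\<close>
  have coarse_part: "q (Q *v e1) \<le> (1 - \<delta>_TG) * q e0"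
  proof (cases "nullspace (psd_sqrt A ** Mtilde ** psd_sqrt A) \<inter> colspace (psd_sqrt A ** P) = {0}")
    case True
    have \<delta>: "\<delta>_TG = eigval (CARD('n) - s + 1) (Mtilde ** (A ** Q))"
      using True \<open>\<delta>_TG = _\<close> by (simp add: Q_def matrix_mul_assoc)
    have quad: "\<delta>_TG * (y \<bullet> ((A ** Q) *v y)) \<le> ((A ** Q) *v y) \<bullet> (Mtilde *v ((A ** Q) *v y))" for y
      unfolding \<delta>
    proof (rule eigval_le_Rayleigh_quotient[OF coarse(1) symMt])
      show "0 \<le> ((A ** Q) *v v) \<bullet> (Mtilde *v ((A ** Q) *v v))" for v
        using posMt[of "Q *v v"] by (simp add: matrix_vector_mul_assoc)
      show "rank (A ** Q) \<le> s" using coarse(2) \<open>s = _\<close> by simp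
    qed
    have "\<delta>_TG * q (Q *v y)
        \<le> (A *v (Q *v y)) \<bullet> (Mtilde *v (A *v (Q *v y)))" for y
      using quad[of y] Pi_adj[of y "Q *v y"]
      by (simp add: q_def APi matrix_vector_mul_assoc[symmetric])
    then have adj_le: "q (adj (Q *v y)) \<le> (1 - \<delta>_TG) * q (Q *v y)" for y
      unfolding q_adj by (simp add: algebra_simps)
    obtain y where "A\<^sub>c *v y \<noteq> 0" using \<open>A\<^sub>c \<noteq> 0\<close> by (auto simp: matrix_eq)
    then have "A *v (P *v y) \<noteq> 0"
      by (auto simp: \<open>A\<^sub>c = _\<close> matrix_vector_mul_assoc[symmetric])
    then have "A *v (Q *v (P *v y)) \<noteq> 0" by (simp add: AP)
    then have "0 < q (Q *v (P *v y))"
      using sym_psd_null[OF A, of "Q *v (P *v y)"] q0[of "Q *v (P *v y)"]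
      by (auto simp: q_def less_le)
    then have "0 \<le> 1 - \<delta>_TG"
      using adj_le[of "P *v y"] q0[of "adj (Q *v (P *v y))"] by (smt (verit) mult_neg_pos)
    moreover have "q (Q *v e1) = (e0 - M *v (A *v e0)) \<bullet> (A *v (Q *v e1))"
      using Pi_adj[of e1 "Q *v e1"] by (simp add: q_def APi e1)
    ultimately show ?thesis
      using energy_le_of_adjoint_energy_le[OF A, of "1 - \<delta>_TG" "Q *v e1" M e0] adj_le[of e1]
      by (simp add: q_def adj_def)
  next
    case False
    then have "\<delta>_TG = 0" using \<open>\<delta>_TG = _\<close> by simp
    have "(q (Q *v e1))\<^sup>2 = (e1 \<bullet> (A *v (Q *v e1)))\<^sup>2"
      using Pi_adj[of e1 "Q *v e1"] by (simp add: q_def APi)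
    also have "\<dots> \<le> q e1 * q (Q *v e1)"
      unfolding q_def by (rule sym_psd_Cauchy_Schwarz[OF A])
    finally have "(q (Q *v e1))\<^sup>2 \<le> q (Q *v e1) * q e1" by (simp add: mult.commute)
    then have "q (Q *v e1) \<le> q e1" by (rule le_of_square_le_mult[OF _ q0 q0])
    also have "\<dots> \<le> q e0" using contr[of e0] by (simp add: e1)
    finally show ?thesis using \<open>\<delta>_TG = 0\<close> by simp
  qed

  \<comment> \<open>Galerkin orthogonality: the exact two-grid error is orthogonal to the range of \<open>P\<close>.\<close>
  have orth: "(e1 - Q *v e1) \<bullet> (A *v (P *v y)) = 0" for y
    using Pi_adj[of e1 "P *v y"] by (simp add: AP inner_diff_left)
  have pyth: "q (e1 - Q *v e1 + P *v y) = q (e1 - Q *v e1) + q (P *v y)" for y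
    unfolding q_def quadratic_form_add[OF symA] orth by simp
  have Ac_q: "y \<bullet> (A\<^sub>c *v y) = q (P *v y)" for y
    using \<open>A\<^sub>c = _\<close>
    by (simp add: q_def matrix_vector_mul_assoc[symmetric] inner_transpose_matrix_vector
        del: transpose_matrix_vector)
  have TG: "u - u_TG = e1 - Q *v e1" using \<open>u_TG = _\<close> by (simp add: e1_def Pec)
  have ITG: "u - u_ITG = e1 - Q *v e1 + P *v (e\<^sub>c - ehat\<^sub>c)"
    using \<open>u_ITG = _\<close> by (simp add: e1_def Pec matrix_vector_mult_diff_distrib)
  have split: "q e1 = q (u - u_TG) + q (Q *v e1)"
    using pyth[of e\<^sub>c] by (simp add: TG Pec)
  have split': "q (u - u_ITG) = q (u - u_TG) + q (P *v (e\<^sub>c - ehat\<^sub>c))"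
    using pyth[of "e\<^sub>c - ehat\<^sub>c"] by (simp add: TG ITG)
  have sn: "seminorm_of A v = sqrt (q v)" "seminorm_of A\<^sub>c y = sqrt (q (P *v y))" for v y
    by (simp_all add: seminorm_of_def q_def Ac_q[unfolded q_def])
  have sq: "a \<le> t\<^sup>2 * b" if "sqrt a \<le> t * sqrt b" "0 \<le> a" "0 \<le> b" for a b t :: real
    using power_mono[OF that(1), of 2] that by (simp add: power_mult_distrib)
  have tg: "q (u - u_TG) \<le> \<rho>\<^sup>2 * q e0"
    by (rule sq[OF _ q0 q0]) (use \<open>seminorm_of A (u - u_TG) \<le> _\<close> in \<open>simp add: sn e0_def\<close>)
  have inexact: "q (P *v (e\<^sub>c - ehat\<^sub>c)) \<le> \<epsilon>\<^sup>2 * q (Q *v e1)"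
    by (rule sq[OF _ q0 q0])
      (use \<open>seminorm_of A\<^sub>c (e\<^sub>c - ehat\<^sub>c) \<le> _\<close> in \<open>simp add: sn Pec\<close>)
  have \<epsilon>2: "0 \<le> \<epsilon>\<^sup>2" "0 \<le> 1 - \<epsilon>\<^sup>2"
    using \<open>0 \<le> \<epsilon>\<close> \<open>\<epsilon> < 1\<close> by (simp_all add: power_le_one)
  have "q (u - u_ITG) \<le> (\<rho>\<^sup>2 + \<epsilon>\<^sup>2 * (1 - (\<rho>\<^sup>2 + lam))) * q e0"
  proof -
    \<comment> \<open>Eliminate the projected error by the Pythagorean identity for \<open>e1\<close>.\<close>
    have "q (u - u_ITG) \<le> (1 - \<epsilon>\<^sup>2) * q (u - u_TG) + \<epsilon>\<^sup>2 * q e1"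
      using split' inexact by (simp add: split algebra_simps)
    also have "\<dots> \<le> (1 - \<epsilon>\<^sup>2) * (\<rho>\<^sup>2 * q e0) + \<epsilon>\<^sup>2 * ((1 - lam) * q e0)"
      by (intro add_mono mult_left_mono tg smooth \<epsilon>2)
    finally show ?thesis by (simp add: algebra_simps)
  qed
  moreover have "q (u - u_ITG) \<le> (\<rho>\<^sup>2 + \<epsilon>\<^sup>2 * (1 - \<delta>_TG)) * q e0"
  proof -
    have "q (u - u_ITG) \<le> \<rho>\<^sup>2 * q e0 + \<epsilon>\<^sup>2 * ((1 - \<delta>_TG) * q e0)"
      unfolding split'
      by (intro add_mono tg order_trans[OF inexact] mult_left_mono coarse_part \<epsilon>2)
    then show ?thesis by (simp add: algebra_simps)
  qed
  ultimately have "q (u - u_ITG) \<le> (\<rho>\<^sup>2 + \<epsilon>\<^sup>2 * (1 - max (\<rho>\<^sup>2 + lam) \<delta>_TG)) * q e0"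
    by (simp add: max_def)
  then show ?thesis
    unfolding sn lam_def[symmetric] e0_def[symmetric] real_sqrt_mult[symmetric]
    by (rule real_sqrt_le_mono)
qed

end
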